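(* Let $\mathcal M$ and $\mathcal N=\{N^{(\lambda)}:\lambda\in\mathbb R_{>0}\}$ be two quasianalytic weight matrices and assume $\lim_{k\to+\infty}(n^{(\lambda)}_k)^{1/k}=+\infty$ for all $\lambda>0$. Then $j^\infty(\mathcal E^{0,r}_{\{\mathcal M\}})\cap\Lambda^r_{(\mathcal N)}$ is Haar-null in $\Lambda^r_{(\mathcal N)}$.
   Context: For a sequence $M=(M_p)_{p\in\mathbb N}$ of positive reals write $m_p:=M_p/p!$. $M$ is a weight sequence if $1=M_0\le M_1$, $M_p^2\le M_{p-1}M_{p+1}$ for all $p\ge1$, and $\liminf_{p\to\infty}m_p^{1/p}>0$; it is quasianalytic if $\sum_{p\ge1}M_{p-1}/M_p=+\infty$. A weight matrix is a family $\mathcal M=\{M^{(\lambda)}:\lambda\in\mathbb R_{>0}\}$ of weight sequences with $M^{(\lambda)}_p\le M^{(\kappa)}_p$ for all $p$ whenever $\lambda\le\kappa$; write $n^{(\lambda)}_p:=N^{(\lambda)}_p/p!$. It is quasianalytic if every member is quasianalytic. For $U\subseteq\mathbb R^r$ open, $K\subseteq U$ compact, $h>0$: $\|f\|^M_{K,h}:=\sup_{\alpha\in\mathbb N^r,x\in K}|\partial^\alpha f(x)|/(h^{|\alpha|}M_{|\alpha|})$. $\mathcal E_{\{\mathcal M\}}(U)$: smooth $f$ such that for every compact $K\subseteq U$ there exist $\lambda>0$, $h>0$ with $\|f\|^{M^{(\lambda)}}_{K,h}<\infty$; $\mathcal E^{0,r}_{\{\mathcal M\}}$ is the space of germs at $0\in\mathbb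 R^r$ of functions in $\mathcal E_{\{\mathcal M\}}((-1/k,1/k)^r)$ for some $k$. For $\mathbf b=(b_\alpha)_{\alpha\in\mathbb N^r}$, a weight sequence $N$, $h>0$: $|\mathbf b|^N_h:=\sup_\alpha|b_\alpha|/(h^{|\alpha|}n_{|\alpha|})$; $\Lambda^r_{(\mathcal N)}:=\{\mathbf b:\forall\lambda>0\,\forall h>0,\ |\mathbf b|^{N^{(\lambda)}}_h<\infty\}$, a Fréchet space with the seminorms $|\cdot|^{N^{(\lambda)}}_h$. The Borel map is $j^\infty(f)=(\partial^\alpha f(0)/|\alpha|!)_{\alpha\in\mathbb N^r}$. In a complete metric vector space $X$, a Borel set $B$ is Haar-null if there is a compactly supported Borel probability measure $\mu$ with $\mu(x+B)=0$ for all $x\in X$; an arbitrary set is Haar-null if it is contained in a Haar-null Borel set. *)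

theory Defs
  imports "HOL-Analysis.Analysis" "HOL-Probability.Probability"
begin

definition weight_seq :: "(nat \<Rightarrow> real) \<Rightarrow> bool" where
  "weight_seq M \<longleftrightarrow>
     (\<forall>p. M p > 0) \<and> M 0 = 1 \<and> M 0 \<le> M 1 \<and>
     (\<forall>p\<ge>1. (M p)\<^sup>2 \<le> M (p - 1) * M (p + 1)) \<and>
     Liminf sequentially (\<lambda>p. ereal (root p (M p / fact p))) > 0"

definition quasianalytic_seq :: "(nat \<Rightarrow> real) \<Rightarrow> bool" where
  "quasianalytic_seq M \<longleftrightarrow>
     filterlim (\<lambda>n. \<Sum>p\<in>{1..n}. M (p - 1) / M p) at_top sequentially"

definition weight_matrix :: "(real \<Rightarrow> nat \<Rightarrow> real) \<Rightarrow> bool" where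
  "weight_matrix Mt \<longleftrightarrow>
     (\<forall>l>0. weight_seq (Mt l)) \<and>
     (\<forall>l k p. 0 < l \<longrightarrow> l \<le> k \<longrightarrow> Mt l p \<le> Mt k p)"

definition quasianalytic_matrix :: "(real \<Rightarrow> nat \<Rightarrow> real) \<Rightarrow> bool" where
  "quasianalytic_matrix Mt \<longleftrightarrow> (\<forall>l>0. quasianalytic_seq (Mt l))"

text \<open>Multi-indices are functions 'n => nat for a finite type 'n (r = CARD('n)).\<close>
definition mlen :: "('n::finite \<Rightarrow> nat) \<Rightarrow> nat" where
  "mlen \<alpha> = (\<Sum>i\<in>UNIV. \<alpha> i)"

text \<open>D is the family of all partial derivatives of f on the open set U:
  D 0 = f, every D alpha is continuous on U, and D (alpha + e_i) is the
  partial derivative in direction i of D alpha, at every point of U.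
  (f is C^infinity on U iff such a D exists; D is then unique on U.)\<close>
definition smooth_with_partials ::
  "(real^'n::finite) set \<Rightarrow> (real^'n \<Rightarrow> real) \<Rightarrow> (('n \<Rightarrow> nat) \<Rightarrow> real^'n \<Rightarrow> real) \<Rightarrow> bool" where
  "smooth_with_partials U f D \<longleftrightarrow>
     (\<forall>x\<in>U. D (\<lambda>_. 0) x = f x) \<and>
     (\<forall>\<alpha>. continuous_on U (D \<alpha>)) \<and>
     (\<forall>\<alpha> i x. x \<in> U \<longrightarrow>
        ((\<lambda>t. D \<alpha> (x + t *\<^sub>R axis i 1)) has_real_derivative D (\<alpha>(i := Suc (\<alpha> i))) x) (at 0))"

definition roumieu_bounds ::
  "(real \<Rightarrow> nat \<Rightarrow> real) \<Rightarrow> (real^'n::finite) set \<Rightarrow> (('n \<Rightarrow> nat) \<Rightarrow> real^'n \<Rightarrow> real) \<Rightarrow> bool" where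
  "roumieu_bounds Mt U D \<longleftrightarrow>
     (\<forall>K. compact K \<and> K \<subseteq> U \<longrightarrow>
        (\<exists>l>0. \<exists>h>0. bdd_above {\<bar>D \<alpha> x\<bar> / (h ^ mlen \<alpha> * Mt l (mlen \<alpha>)) | \<alpha> x. x \<in> K}))"

definition E_roumieu :: "(real \<Rightarrow> nat \<Rightarrow> real) \<Rightarrow> (real^'n::finite) set \<Rightarrow> (real^'n \<Rightarrow> real) set" where
  "E_roumieu Mt U = {f. \<exists>D. smooth_with_partials U f D \<and> roumieu_bounds Mt U D}"

definition cube :: "nat \<Rightarrow> (real^'n::finite) set" where
  "cube k = {x. \<forall>i. \<bar>x $ i\<bar> < 1 / real k}"

definition jets_of_germs :: "(real \<Rightarrow> nat \<Rightarrow> real) \<Rightarrow> (('n::finite \<Rightarrow> nat) \<Rightarrow> real) set" where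
  "jets_of_germs Mt =
     {b. \<exists>k>0. \<exists>(f :: real^'n \<Rightarrow> real) D.
          smooth_with_partials (cube k) f D \<and> roumieu_bounds Mt (cube k) D \<and>
          b = (\<lambda>\<alpha>. D \<alpha> 0 / fact (mlen \<alpha>))}"

definition seqnorm :: "(real \<Rightarrow> nat \<Rightarrow> real) \<Rightarrow> real \<Rightarrow> real \<Rightarrow> (('n::finite \<Rightarrow> nat) \<Rightarrow> real) \<Rightarrow> real" where
  "seqnorm Nt l h b = (SUP \<alpha>. \<bar>b \<alpha>\<bar> / (h ^ mlen \<alpha> * (Nt l (mlen \<alpha>) / fact (mlen \<alpha>))))"

definition Lambda_beurling :: "(real \<Rightarrow> nat \<Rightarrow> real) \<Rightarrow> (('n::finite \<Rightarrow> nat) \<Rightarrow> real) set" where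
  "Lambda_beurling Nt =
     {b. \<forall>l>0. \<forall>h>0. bdd_above (range (\<lambda>\<alpha>. \<bar>b \<alpha>\<bar> / (h ^ mlen \<alpha> * (Nt l (mlen \<alpha>) / fact (mlen \<alpha>)))))}"

definition Lambda_open :: "(real \<Rightarrow> nat \<Rightarrow> real) \<Rightarrow> (('n::finite \<Rightarrow> nat) \<Rightarrow> real) set \<Rightarrow> bool" where
  "Lambda_open Nt U \<longleftrightarrow> U \<subseteq> Lambda_beurling Nt \<and>
     (\<forall>x\<in>U. \<exists>l>0. \<exists>h>0. \<exists>e>0.
        {y \<in> Lambda_beurling Nt. seqnorm Nt l h (\<lambda>\<alpha>. y \<alpha> - x \<alpha>) < e} \<subseteq> U)"

definition Lambda_top :: "(real \<Rightarrow> nat \<Rightarrow> real) \<Rightarrow> (('n::finite \<Rightarrow> nat) \<Rightarrow> real) topology" where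
  "Lambda_top Nt = topology (Lambda_open Nt)"

definition Lambda_borel :: "(real \<Rightarrow> nat \<Rightarrow> real) \<Rightarrow> (('n::finite \<Rightarrow> nat) \<Rightarrow> real) set set" where
  "Lambda_borel Nt = sigma_sets (Lambda_beurling Nt) {U. openin (Lambda_top Nt) U}"

definition haar_null_borel_Lambda :: "(real \<Rightarrow> nat \<Rightarrow> real) \<Rightarrow> (('n::finite \<Rightarrow> nat) \<Rightarrow> real) set \<Rightarrow> bool" where
  "haar_null_borel_Lambda Nt B \<longleftrightarrow>
     B \<in> Lambda_borel Nt \<and>
     (\<exists>\<mu>. prob_space \<mu> \<and> space \<mu> = Lambda_beurling Nt \<and> sets \<mu> = Lambda_borel Nt \<and>
        (\<exists>K. compactin (Lambda_top Nt) K \<and> K \<in> sets \<mu> \<and> emeasure \<mu> K = 1) \<and>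
        (\<forall>x\<in>Lambda_beurling Nt. emeasure \<mu> ((\<lambda>y. \<lambda>\<alpha>. x \<alpha> + y \<alpha>) ` B) = 0))"

definition haar_null_Lambda :: "(real \<Rightarrow> nat \<Rightarrow> real) \<Rightarrow> (('n::finite \<Rightarrow> nat) \<Rightarrow> real) set \<Rightarrow> bool" where
  "haar_null_Lambda Nt A \<longleftrightarrow> (\<exists>B. A \<subseteq> B \<and> haar_null_borel_Lambda Nt B)"

end

theory Submission
  imports Defs
begin

text \<open>
  Restricting to a coordinate axis reduces everything to one variable. Let $g$ be smooth on $[0,d]$
  with $|g^{(n)}| \le M_n$, where $M$ is log-convex and quasianalytic, and suppose that
  $g^{(n)}(0) \ge 0$ for all $n < N$. Moving to the right, a lower bound
  $g^{(j)} \ge - e^{j-m-1} M_j$ for all $j \le m$ deteriorates by at most a factor $e$ over a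
  distance $M_m / (e M_{m+1})$ (Bang's argument applied to the negative parts). It holds at $0$
  with $m + 1 = N$, and the sum of these distances diverges, so for $N$ large the derivatives of
  low order are almost nonnegative on all of $[0,d]$. By Taylor's formula the partial sums of the
  Taylor series of $g$ at $0$, evaluated at $d$, are then bounded by about $M_0$.

  This estimate involves only finitely many coefficients at a time, hence it survives pointwise
  limits: a positive sequence growing faster than every geometric one does not even lie in the
  pointwise closure of the jets with given bounds. The union $B$ of these closures over a countable
  family of bounds is a Borel linear subspace containing all jets, and the assumption on the second
  matrix provides such a fast sequence $b$ inside $\Lambda$. Every translate of $B$ meets the line
  through $b$ in at most one point, so Lebesgue measure on the segment from $0$ to $b$ witnesses
  that $B$ is Haar-null.
\<close>

subsection \<open>Propagation of lower bounds for derivatives\<close>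

text \<open>Log-convexity makes the quotients \<open>M (Suc k) / M k\<close> increase with
  \<open>k\<close>, so each of the \<open>i\<close> factors leading from \<open>M j\<close> to
  \<open>M (j + i)\<close> is at most the quotient at \<open>m\<close>.\<close>

lemma log_convex_growth:
  fixes M :: "nat \<Rightarrow> real"
  assumes pos: "\<And>n. M n > 0"
    and lc: "\<And>n. (M (Suc n))\<^sup>2 \<le> M n * M (Suc (Suc n))"
    and le: "j + i \<le> Suc m"
  shows "M (j + i) \<le> M j * (M (Suc m) / M m) ^ i"
proof -
  have "M (Suc n) / M n \<le> M (Suc (Suc n)) / M (Suc n)" for n
    using lc[of n] pos[of n] pos[of "Suc n"]
    by (simp add: divide_simps power2_eq_square mult.commute)
  then have ratio: "M (Suc k) / M k \<le> M (Suc m) / M m" if "k \<le> m" for k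
    using that by (rule lift_Suc_mono_le[where f = "\<lambda>n. M (Suc n) / M n"])
  show ?thesis
    using le
  proof (induction i)
    case 0
    then show ?case by simp
  next
    case (Suc i)
    have "M (j + Suc i) = M (j + i) * (M (Suc (j + i)) / M (j + i))"
      using pos[of "j + i"] by simp
    also have "\<dots> \<le> (M j * (M (Suc m) / M m) ^ i) * (M (Suc m) / M m)"
      using Suc ratio[of "j + i"] pos
      by (intro mult_mono) (auto simp: less_imp_le intro!: mult_nonneg_nonneg zero_le_power divide_nonneg_nonneg)
    finally show ?case by (simp add: mult_ac)
  qed
qed

text \<open>Expand \<open>g j\<close> at \<open>x\<close> to order \<open>Suc m - j\<close>, so that
  the remainder is a derivative of order \<open>Suc m\<close>. The term of degree \<open>i\<close>
  is then at least \<open>- E / fact i\<close>, where \<open>- E\<close> is the assumed lower bound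
  for \<open>g j x\<close>. Summation costs at most the factor \<open>exp 1\<close>, which turns
  \<open>exp (- real (Suc m))\<close> into \<open>exp (- real m)\<close>.\<close>

lemma lower_bound_step:
  fixes M :: "nat \<Rightarrow> real" and g :: "nat \<Rightarrow> real \<Rightarrow> real"
  assumes pos: "\<And>n. M n > 0"
    and lc: "\<And>n. (M (Suc n))\<^sup>2 \<le> M n * M (Suc (Suc n))"
    and der: "\<And>n t. 0 \<le> t \<Longrightarrow> t \<le> d \<Longrightarrow> (g n has_real_derivative g (Suc n) t) (at t)"
    and bd: "\<And>n t. 0 \<le> t \<Longrightarrow> t \<le> d \<Longrightarrow> \<bar>g n t\<bar> \<le> M n"
    and xy: "0 \<le> x" "x \<le> y" "y \<le> d"
    and step: "y - x \<le> M m / (exp 1 * M (Suc m))"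
    and low: "\<And>j. j < Suc m \<Longrightarrow> - (exp (- real (Suc m)) * exp (real j) * M j) \<le> g j x"
    and j: "j < Suc m"
  shows "- (exp (- real m) * exp (real j) * M j) \<le> g j y"
proof (cases "x = y")
  case True
  have "exp (- real (Suc m)) * exp (real j) * M j \<le> exp (- real m) * exp (real j) * M j"
    using pos[of j] by (intro mult_right_mono) auto
  then show ?thesis using low[OF j] unfolding True[symmetric] by (meson neg_le_iff_le order_trans)
next
  case False
  define h where "h = y - x"
  define n where "n = Suc m - j"
  have h: "0 < h" using False xy h_def by simp
  have n: "0 < n" "j + n = Suc m" using j n_def by auto
  have "\<exists>t. x < t \<and> t < y \<and>
      g j y = (\<Sum>i<n. g (j + i) x / fact i * (y - x) ^ i) + g (j + n) t / fact n * (y - x) ^ n"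
    using Taylor_up[of n "\<lambda>i. g (j + i)" "g j" 0 y x] n(1) der xy False by auto
  then obtain t where t: "x < t" "t < y"
    and eq: "g j y = (\<Sum>i<n. g (j + i) x / fact i * h ^ i) + g (j + n) t / fact n * h ^ n"
    unfolding h_def by blast
  define E where "E = exp (- real (Suc m)) * exp (real j) * M j"
  have E: "0 < E" using pos E_def by simp
  \<comment> \<open>The weights for order \<open>j + i\<close> exceed \<open>E\<close> by at most
    the factor \<open>(exp 1 * r) ^ i\<close>; the restriction on the step length is
    \<open>exp 1 * r * h \<le> 1\<close>, so \<open>h ^ i\<close> compensates for it.\<close>
  have weight: "exp (- real (Suc m)) * exp (real (j + i)) * M (j + i) * h ^ i \<le> E"
    if "i \<le> n" for i
  proof -
    define r where "r = M (Suc m) / M m"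
    have r: "0 < r" using pos r_def by simp
    have "exp 1 * r * h \<le> 1"
      using step pos[of m] pos[of "Suc m"] unfolding r_def h_def
      by (simp add: field_simps)
    then have le1: "(exp 1 * r * h) ^ i \<le> 1"
      using r h by (intro power_le_one) auto
    have "M (j + i) \<le> M j * r ^ i"
      unfolding r_def using that n by (intro log_convex_growth pos lc) auto
    then have "exp (- real (Suc m)) * exp (real (j + i)) * M (j + i) * h ^ i
        \<le> exp (- real (Suc m)) * exp (real (j + i)) * (M j * r ^ i) * h ^ i"
      using h by (intro mult_right_mono mult_left_mono) auto
    also have "\<dots> = E * (exp 1 * r * h) ^ i"
    proof -
      have "exp (real (j + i)) = exp (real j) * exp 1 ^ i"
        by (simp add: exp_add exp_of_nat_mult[symmetric])
      then show ?thesis unfolding E_def by (simp add: power_mult_distrib mult_ac)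
    qed
    also have "\<dots> \<le> E"
      using E le1 by (simp add: mult_le_cancel_left1)
    finally show ?thesis .
  qed
  have term_le: "- (E / fact i) \<le> g (j + i) x / fact i * h ^ i" if "i < n" for i
  proof -
    have "- (exp (- real (Suc m)) * exp (real (j + i)) * M (j + i)) * h ^ i \<le> g (j + i) x * h ^ i"
      using low[of "j + i"] that n h by (intro mult_right_mono) auto
    then have "- E \<le> g (j + i) x * h ^ i"
      using weight[of i] that by simp
    then show ?thesis
      by (simp add: field_simps)
  qed
  \<comment> \<open>No one-sided information is available at order \<open>Suc m\<close>, but there
    the exponential weight equals 1, so the plain bound \<open>bd\<close> is enough.\<close>
  have last_le: "- (E / fact n) \<le> g (j + n) t / fact n * h ^ n"
  proof -
    have "exp (- real (Suc m)) * exp (real (j + n)) = 1"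
      using n by (simp add: exp_add[symmetric])
    then have "M (j + n) * h ^ n \<le> E"
      using weight[of n] by simp
    moreover have "- M (j + n) * h ^ n \<le> g (j + n) t * h ^ n"
      using bd[of t "j + n"] t xy h by (intro mult_right_mono) auto
    ultimately have "- E \<le> g (j + n) t * h ^ n" by simp
    then show ?thesis
      by (simp add: field_simps)
  qed
  have "(\<Sum>i<n. 1 / fact i) + 1 / fact n = (\<Sum>i<Suc n. (1 / fact i :: real))"
    by simp
  also have "\<dots> \<le> exp 1"
    using sum_le_suminf[OF summable_exp[of "1::real"], of "{..<Suc n}"]
    by (simp add: exp_def inverse_eq_divide)
  finally have "E * ((\<Sum>i<n. 1 / fact i) + 1 / fact n) \<le> E * exp 1"
    using E by (intro mult_left_mono) auto
  moreover have "- (\<Sum>i<n. E / fact i) \<le> (\<Sum>i<n. g (j + i) x / fact i * h ^ i)"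
    unfolding sum_negf[symmetric] using term_le by (intro sum_mono) auto
  ultimately have "- (E * exp 1) \<le> g j y"
    using last_le unfolding eq by (simp add: sum_distrib_left algebra_simps)
  moreover have "E * exp 1 = exp (- real m) * exp (real j) * M j"
    unfolding E_def by (simp add: exp_add[symmetric] exp_minus field_simps)
  ultimately show ?thesis by simp
qed

text \<open>Walk from 0 to \<open>x\<close> by repeated use of \<open>lower_bound_step\<close>,
  losing one order of derivative per step; the allowed step lengths add up to the sum in
  \<open>far\<close>.\<close>

lemma almost_nonneg_derivatives:
  fixes M :: "nat \<Rightarrow> real" and g :: "nat \<Rightarrow> real \<Rightarrow> real"
  assumes pos: "\<And>n. M n > 0"
    and lc: "\<And>n. (M (Suc n))\<^sup>2 \<le> M n * M (Suc (Suc n))"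
    and der: "\<And>n t. 0 \<le> t \<Longrightarrow> t \<le> d \<Longrightarrow> (g n has_real_derivative g (Suc n) t) (at t)"
    and bd: "\<And>n t. 0 \<le> t \<Longrightarrow> t \<le> d \<Longrightarrow> \<bar>g n t\<bar> \<le> M n"
    and x: "0 \<le> x" "x \<le> d"
    and nonneg: "\<And>j. j < N \<Longrightarrow> 0 \<le> g j 0"
    and far: "d \<le> (\<Sum>n\<in>{m..<N}. M n / (exp 1 * M (Suc n)))"
    and m: "m \<le> N" "j < m"
  shows "- (exp (- real m) * exp (real j) * M j) \<le> g j x"
proof -
  \<comment> \<open>\<open>X k\<close> is the point reached once the steps with indices
    \<open>N - 1\<close> down to \<open>k\<close> are made, cut off at \<open>x\<close>. Thus
    \<open>X N = 0\<close>, where the signs are known, and \<open>far\<close> gives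
    \<open>X m = x\<close>.\<close>
  define X where "X k = min x (\<Sum>n\<in>{k..<N}. M n / (exp 1 * M (Suc n)))" for k
  have term_nonneg: "0 \<le> M n / (exp 1 * M (Suc n))" for n
    using pos by (simp add: less_imp_le)
  have "\<forall>j<m. - (exp (- real m) * exp (real j) * M j) \<le> g j (X m)"
    using m(1)
  proof (induction m rule: inc_induct)
    case base
    have "X N = 0" using x by (simp add: X_def)
    moreover have "0 \<le> exp (- real N) * exp (real j) * M j" for j
      using pos[of j] by simp
    ultimately show ?case
      using nonneg by (smt (verit))
  next
    case (step k)
    have split: "(\<Sum>n\<in>{k..<N}. M n / (exp 1 * M (Suc n))) =
        M k / (exp 1 * M (Suc k)) + (\<Sum>n\<in>{Suc k..<N}. M n / (exp 1 * M (Suc n)))"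
      using step.hyps by (simp add: sum.atLeast_Suc_lessThan)
    have "- (exp (- real k) * exp (real j) * M j) \<le> g j (X k)" if "j < k" for j
    proof (rule lower_bound_step[where M = M and g = g, OF pos lc der bd])
      show "0 \<le> X (Suc k)"
        using x term_nonneg by (auto simp: X_def intro!: sum_nonneg)
      show "X (Suc k) \<le> X k" "X k \<le> d" "X k - X (Suc k) \<le> M k / (exp 1 * M (Suc k))"
        using split term_nonneg[of k] x unfolding X_def by linarith+
    qed (use step.IH that in auto)
    then show ?case by blast
  qed
  moreover have "X m = x" using far x by (simp add: X_def)
  ultimately show ?thesis using m by auto
qed

text \<open>In the Taylor expansion of order \<open>P\<close> at 0, evaluated at \<open>d\<close>,
  the remainder is almost nonnegative, so the partial sum exceeds \<open>g 0 d\<close>, which is at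
  most \<open>M 0\<close>, only by the small error.\<close>

lemma taylor_partial_sum_bound:
  fixes M :: "nat \<Rightarrow> real" and g :: "nat \<Rightarrow> real \<Rightarrow> real"
  assumes pos: "\<And>n. M n > 0"
    and lc: "\<And>n. (M (Suc n))\<^sup>2 \<le> M n * M (Suc (Suc n))"
    and der: "\<And>n t. 0 \<le> t \<Longrightarrow> t \<le> d \<Longrightarrow> (g n has_real_derivative g (Suc n) t) (at t)"
    and bd: "\<And>n t. 0 \<le> t \<Longrightarrow> t \<le> d \<Longrightarrow> \<bar>g n t\<bar> \<le> M n"
    and d: "0 < d"
    and nonneg: "\<And>j. j < N \<Longrightarrow> 0 \<le> g j 0"
    and far: "d \<le> (\<Sum>n\<in>{m..<N}. M n / (exp 1 * M (Suc n)))"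
    and m: "m \<le> N" "P < m" "0 < P"
  shows "(\<Sum>p<P. g p 0 / fact p * d ^ p) \<le> M 0 + exp (- real m) * (exp (real P) * M P * d ^ P / fact P)"
proof -
  have "\<exists>t. 0 < t \<and> t < d \<and>
      g 0 d = (\<Sum>i<P. g i 0 / fact i * (d - 0) ^ i) + g P t / fact P * (d - 0) ^ P"
    using Taylor_up[of P g "g 0" 0 d 0] m d der by auto
  then obtain t where t: "0 < t" "t < d"
    and eq: "g 0 d = (\<Sum>i<P. g i 0 / fact i * d ^ i) + g P t / fact P * d ^ P"
    by auto
  have "- (exp (- real m) * exp (real P) * M P) \<le> g P t"
    by (rule almost_nonneg_derivatives[where M = M and g = g, OF pos lc der bd _ _ nonneg far m(1,2)]) (use t in auto)
  then have "- (exp (- real m) * exp (real P) * M P) * (d ^ P / fact P) \<le> g P t * (d ^ P / fact P)"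
    using d by (intro mult_right_mono) auto
  moreover have "g 0 d \<le> M 0" using bd[of d 0] d by auto
  ultimately show ?thesis
    using eq by (simp add: mult_ac)
qed

subsection \<open>One-variable jets with uniform bounds\<close>

text \<open>A single parameter bounds the length of the interval, the constant, the radius and the
  matrix index simultaneously, so that countably many of these sets exhaust all jets.\<close>
definition axis_jets :: "(real \<Rightarrow> nat \<Rightarrow> real) \<Rightarrow> nat \<Rightarrow> (nat \<Rightarrow> real) set" where
  "axis_jets Mt j = {c. \<exists>g.
     (\<forall>n t. 0 \<le> t \<longrightarrow> t \<le> 1 / real j \<longrightarrow> (g n has_real_derivative g (Suc n) t) (at t)) \<and>
     (\<forall>n t. 0 \<le> t \<longrightarrow> t \<le> 1 / real j \<longrightarrow> \<bar>g n t\<bar> \<le> real j ^ Suc n * Mt (real j) n) \<and>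
     (\<forall>n. c n = g n 0 / fact n)}"

lemma weight_matrix_pos: "weight_matrix Mt \<Longrightarrow> 0 < l \<Longrightarrow> 0 < Mt l p"
  unfolding weight_matrix_def weight_seq_def by blast

lemma weight_matrix_mono: "weight_matrix Mt \<Longrightarrow> 0 < l \<Longrightarrow> l \<le> k \<Longrightarrow> Mt l p \<le> Mt k p"
  by (simp add: weight_matrix_def)

lemma weight_matrix_log_convex:
  assumes "weight_matrix Mt" "0 < l"
  shows "(Mt l (Suc n))\<^sup>2 \<le> Mt l n * Mt l (Suc (Suc n))"
proof -
  have "\<forall>p\<ge>1. (Mt l p)\<^sup>2 \<le> Mt l (p - 1) * Mt l (p + 1)"
    using assms unfolding weight_matrix_def weight_seq_def by blast
  from this[rule_format, of "Suc n"] show ?thesis by simp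
qed

text \<open>This makes the union of the sets over positive \<open>j\<close> a linear subspace. The
  exponent \<open>Suc n\<close> leaves one factor \<open>real j\<close> as a constant; enlarging it
  to \<open>real k\<close> absorbs \<open>2 * \<bar>a\<bar>\<close>.\<close>

lemma axis_jets_scaled_diff:
  assumes Mt: "weight_matrix Mt" and j: "0 < j" "j \<le> k" and a: "2 * \<bar>a\<bar> * real j \<le> real k"
    and c: "c \<in> axis_jets Mt j" "c' \<in> axis_jets Mt j"
  shows "(\<lambda>n. a * (c n - c' n)) \<in> axis_jets Mt k"
proof -
  from c(1) obtain g where
    g: "\<And>n t. 0 \<le> t \<Longrightarrow> t \<le> 1 / real j \<Longrightarrow> (g n has_real_derivative g (Suc n) t) (at t)"
      "\<And>n t. 0 \<le> t \<Longrightarrow> t \<le> 1 / real j \<Longrightarrow> \<bar>g n t\<bar> \<le> real j ^ Suc n * Mt (real j) n"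
      "\<And>n. c n = g n 0 / fact n"
    unfolding axis_jets_def by blast
  from c(2) obtain g' where
    g': "\<And>n t. 0 \<le> t \<Longrightarrow> t \<le> 1 / real j \<Longrightarrow> (g' n has_real_derivative g' (Suc n) t) (at t)"
      "\<And>n t. 0 \<le> t \<Longrightarrow> t \<le> 1 / real j \<Longrightarrow> \<bar>g' n t\<bar> \<le> real j ^ Suc n * Mt (real j) n"
      "\<And>n. c' n = g' n 0 / fact n"
    unfolding axis_jets_def by blast
  have short: "t \<le> 1 / real j" if "t \<le> 1 / real k" for t
    using that j by (meson frac_le le_numeral_extra(4) of_nat_0_less_iff of_nat_mono order_trans zero_le_one)
  let ?G = "\<lambda>n t. a * (g n t - g' n t)"
  have "\<bar>?G n t\<bar> \<le> real k ^ Suc n * Mt (real k) n" if t: "0 \<le> t" "t \<le> 1 / real k" for n t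
  proof -
    have "\<bar>?G n t\<bar> \<le> \<bar>a\<bar> * (\<bar>g n t\<bar> + \<bar>g' n t\<bar>)"
      unfolding abs_mult by (intro mult_left_mono) auto
    also have "\<dots> \<le> \<bar>a\<bar> * (2 * (real j ^ Suc n * Mt (real j) n))"
      using g(2)[of t n] g'(2)[of t n] t short by (intro mult_left_mono) auto
    also have "\<dots> = (2 * \<bar>a\<bar> * real j) * real j ^ n * Mt (real j) n"
      by simp
    also have "\<dots> \<le> real k * real k ^ n * Mt (real k) n"
      using a j weight_matrix_pos[OF Mt, of "real j" n] weight_matrix_mono[OF Mt, of "real j" "real k" n]
      by (intro mult_mono power_mono) auto
    finally show ?thesis by simp
  qed
  moreover have "(?G n has_real_derivative ?G (Suc n) t) (at t)" if "0 \<le> t" "t \<le> 1 / real k" for n t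
    using that short g(1) g'(1) by (auto intro!: derivative_eq_intros)
  moreover have "a * (c n - c' n) = ?G n 0 / fact n" for n
    by (simp add: g(3) g'(3) diff_divide_distrib[symmetric])
  ultimately show ?thesis
    unfolding axis_jets_def mem_Collect_eq by (intro exI[of _ ?G] conjI allI impI)
qed

lemma axis_jets_mono:
  assumes "weight_matrix Mt" "0 < j" "j \<le> k"
  shows "axis_jets Mt j \<subseteq> axis_jets Mt k"
proof
  fix c assume "c \<in> axis_jets Mt j"
  then obtain g where
    g: "\<And>n t. 0 \<le> t \<Longrightarrow> t \<le> 1 / real j \<Longrightarrow> (g n has_real_derivative g (Suc n) t) (at t)"
      "\<And>n t. 0 \<le> t \<Longrightarrow> t \<le> 1 / real j \<Longrightarrow> \<bar>g n t\<bar> \<le> real j ^ Suc n * Mt (real j) n"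
      "\<And>n. c n = g n 0 / fact n"
    unfolding axis_jets_def by blast
  have short: "t \<le> 1 / real j" if "t \<le> 1 / real k" for t
    using that assms by (meson frac_le le_numeral_extra(4) of_nat_0_less_iff of_nat_mono order_trans zero_le_one)
  have "real j ^ Suc n * Mt (real j) n \<le> real k ^ Suc n * Mt (real k) n" for n
    using assms weight_matrix_pos[OF assms(1), of "real j" n]
      weight_matrix_mono[OF assms(1), of "real j" "real k" n]
    by (intro mult_mono power_mono) auto
  then show "c \<in> axis_jets Mt k"
    unfolding axis_jets_def using g short order_trans by blast
qed

section \<open>Pointwise closures of the jet sets\<close>

lemma closure_fun_sequential:
  fixes S :: "(nat \<Rightarrow> real) set"
  shows "c \<in> closure S \<longleftrightarrow> (\<exists>s. (\<forall>k. s k \<in> S) \<and> (\<forall>n. (\<lambda>k. s k n) \<longlonglongrightarrow> c n))"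
proof -
  \<comment> \<open>Convergence in the product topology is coordinatewise, and sequences suffice to
    describe closures there because the index set is countable.\<close>
  have "(s \<longlonglongrightarrow> c) \<longleftrightarrow> (\<forall>n. (\<lambda>k. s k n) \<longlonglongrightarrow> c n)" for s :: "nat \<Rightarrow> nat \<Rightarrow> real"
    using limitin_componentwise[of "\<lambda>_. euclidean" UNIV s c sequentially]
    by (simp add: euclidean_product_topology)
  then show ?thesis unfolding closure_sequential by simp
qed

lemma closure_axis_jets_scaled_diff:
  assumes Mt: "weight_matrix Mt" and j: "0 < j" "j \<le> k" and a: "2 * \<bar>a\<bar> * real j \<le> real k"
    and c: "c \<in> closure (axis_jets Mt j)" "c' \<in> closure (axis_jets Mt j)"
  shows "(\<lambda>n. a * (c n - c' n)) \<in> closure (axis_jets Mt k)"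
proof -
  obtain s where s: "\<And>i. s i \<in> axis_jets Mt j" "\<And>n. (\<lambda>i. s i n) \<longlonglongrightarrow> c n"
    using c(1) unfolding closure_fun_sequential by blast
  obtain s' where s': "\<And>i. s' i \<in> axis_jets Mt j" "\<And>n. (\<lambda>i. s' i n) \<longlonglongrightarrow> c' n"
    using c(2) unfolding closure_fun_sequential by blast
  have "(\<lambda>n. a * (s i n - s' i n)) \<in> axis_jets Mt k" for i
    by (intro axis_jets_scaled_diff[OF Mt j a] s s')
  moreover have "(\<lambda>i. a * (s i n - s' i n)) \<longlonglongrightarrow> a * (c n - c' n)" for n
    by (intro tendsto_intros s s')
  ultimately show ?thesis
    unfolding closure_fun_sequential by (intro exI[of _ "\<lambda>i n. a * (s i n - s' i n)"]) auto
qed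

text \<open>Positivity of \<open>c\<close> passes to any finite number of coefficients of a late
  approximant, so the Taylor estimate at \<open>1 / real j\<close> applies to it. In the limit all
  terms of the partial sum are positive, and each one alone obeys the bound.\<close>

lemma closure_axis_jets_positive_growth:
  assumes Mt: "weight_matrix Mt" "quasianalytic_matrix Mt" and j: "0 < j"
    and c: "c \<in> closure (axis_jets Mt j)" and cpos: "\<And>n. 0 < c n"
  shows "c n \<le> (real j + 1) * real j ^ n"
proof -
  \<comment> \<open>The constant and the radius are absorbed into the weights: a geometric factor
    preserves log-convexity and only divides the terms of the quasianalyticity series by
    \<open>real j\<close>.\<close>
  define M where "M n = real j ^ Suc n * Mt (real j) n" for n
  define d where "d = 1 / real j"
  define P where "P = Suc n"
  have d: "0 < d" using j d_def by simp
  have Mpos: "0 < M n" for n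
    unfolding M_def using weight_matrix_pos[OF Mt(1), of "real j"] j by simp
  have lc: "(M (Suc n))\<^sup>2 \<le> M n * M (Suc (Suc n))" for n
  proof -
    have "real j ^ (2 * n + 4) * (Mt (real j) (Suc n))\<^sup>2
        \<le> real j ^ (2 * n + 4) * (Mt (real j) n * Mt (real j) (Suc (Suc n)))"
      using weight_matrix_log_convex[OF Mt(1), of "real j" n] j by (intro mult_left_mono) auto
    then show ?thesis
      unfolding M_def
      by (simp add: power_mult_distrib power2_eq_square power_add mult_2 mult_ac numeral_eq_Suc)
  qed
  have M0: "M 0 = real j"
    using Mt(1) j unfolding M_def weight_matrix_def weight_seq_def by simp
  have div: "filterlim (\<lambda>N. \<Sum>p\<in>{0..<N}. M p / (exp 1 * M (Suc p))) at_top sequentially"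
  proof -
    have "filterlim (\<lambda>N. \<Sum>p\<in>{1..N}. Mt (real j) (p - 1) / Mt (real j) p) at_top sequentially"
      using Mt(2) j unfolding quasianalytic_matrix_def quasianalytic_seq_def by simp
    then have "filterlim (\<lambda>N. 1 / (exp 1 * real j) *
        (\<Sum>p\<in>{1..N}. Mt (real j) (p - 1) / Mt (real j) p)) at_top sequentially"
      using j by (intro filterlim_tendsto_pos_mult_at_top[OF tendsto_const]) auto
    moreover have "1 / (exp 1 * real j) * (\<Sum>p\<in>{1..N}. Mt (real j) (p - 1) / Mt (real j) p)
        = (\<Sum>p\<in>{0..<N}. M p / (exp 1 * M (Suc p)))" for N
    proof -
      have "(\<Sum>p\<in>{1..N}. Mt (real j) (p - 1) / Mt (real j) p)
          = (\<Sum>p\<in>{0..<N}. Mt (real j) p / Mt (real j) (Suc p))"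
        by (rule sum.reindex_bij_witness[of _ Suc "\<lambda>p. p - 1"]) auto
      then show ?thesis
        using j by (simp add: sum_distrib_left M_def mult.assoc)
    qed
    ultimately show ?thesis by simp
  qed
  obtain s where s: "\<And>i. s i \<in> axis_jets Mt j" "\<And>n. (\<lambda>i. s i n) \<longlonglongrightarrow> c n"
    using c unfolding closure_fun_sequential by blast
  \<comment> \<open>The order of choices matters: \<open>R\<close> depends only on \<open>P\<close>,
    then \<open>m\<close> makes the error at most 1, then \<open>N\<close> makes the walk from order
    \<open>N\<close> to order \<open>m\<close> long enough. None of them depends on the
    approximant.\<close>
  define R where "R = exp (real P) * M P * d ^ P / fact P"
  obtain m where m: "P < m" "exp (- real m) * R \<le> 1"
  proof -
    have "((\<lambda>m. exp (- real m) * R) \<longlongrightarrow> 0 * R) sequentially"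
      by (intro tendsto_intros filterlim_compose[OF exp_at_bot]) 
         (simp add: filterlim_uminus_at_bot filterlim_real_sequentially)
    then have "\<forall>\<^sub>F m in sequentially. exp (- real m) * R < 1"
      by (intro order_tendstoD) auto
    then have "\<forall>\<^sub>F m in sequentially. exp (- real m) * R < 1 \<and> P < m"
      using eventually_gt_at_top by eventually_elim auto
    then show ?thesis using that by (auto dest!: eventually_happens' [OF sequentially_bot])
  qed
  obtain N where N: "m \<le> N" "d \<le> (\<Sum>p\<in>{m..<N}. M p / (exp 1 * M (Suc p)))"
  proof -
    have "\<forall>\<^sub>F N in sequentially. (\<Sum>p\<in>{0..<m}. M p / (exp 1 * M (Suc p))) + d
        \<le> (\<Sum>p\<in>{0..<N}. M p / (exp 1 * M (Suc p)))"
      using div by (simp add: filterlim_at_top)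
    then have "\<forall>\<^sub>F N in sequentially. m \<le> N \<and> (\<Sum>p\<in>{0..<m}. M p / (exp 1 * M (Suc p))) + d
        \<le> (\<Sum>p\<in>{0..<N}. M p / (exp 1 * M (Suc p)))"
      using eventually_ge_at_top by eventually_elim auto
    then obtain N where "m \<le> N" "(\<Sum>p\<in>{0..<m}. M p / (exp 1 * M (Suc p))) + d
        \<le> (\<Sum>p\<in>{0..<N}. M p / (exp 1 * M (Suc p)))"
      by (auto dest!: eventually_happens' [OF sequentially_bot])
    then show ?thesis
      using that sum.atLeastLessThan_concat[of 0 m N "\<lambda>p. M p / (exp 1 * M (Suc p))"] by auto
  qed
  have bound: "(\<Sum>p<P. s i p * d ^ p) \<le> real j + 1" if nn: "\<forall>p<N. 0 \<le> s i p" for i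
  proof -
    from s(1)[of i] obtain g where
      g: "\<And>n t. 0 \<le> t \<Longrightarrow> t \<le> d \<Longrightarrow> (g n has_real_derivative g (Suc n) t) (at t)"
        "\<And>n t. 0 \<le> t \<Longrightarrow> t \<le> d \<Longrightarrow> \<bar>g n t\<bar> \<le> M n"
        "\<And>n. s i n = g n 0 / fact n"
      unfolding axis_jets_def M_def d_def by blast
    have nonneg: "0 \<le> g p 0" if "p < N" for p
    proof -
      have "g p 0 = s i p * fact p" by (simp add: g(3))
      then show ?thesis using nn that by simp
    qed
    have "(\<Sum>p<P. g p 0 / fact p * d ^ p) \<le> M 0 + exp (- real m) * R"
      unfolding R_def
      by (rule taylor_partial_sum_bound[where M = M and g = g, OF Mpos lc g(1,2) d nonneg N(2,1) m(1)])
         (auto simp: P_def)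
    then show ?thesis using M0 m by (simp add: g(3))
  qed
  have "\<forall>\<^sub>F i in sequentially. \<forall>p\<in>{..<N}. 0 < s i p"
    using order_tendstoD(1)[OF s(2) cpos] by (intro eventually_ball_finite) auto
  then have "\<forall>\<^sub>F i in sequentially. (\<Sum>p<P. s i p * d ^ p) \<le> real j + 1"
    by eventually_elim (intro bound, auto simp: less_imp_le)
  moreover have "(\<lambda>i. \<Sum>p<P. s i p * d ^ p) \<longlonglongrightarrow> (\<Sum>p<P. c p * d ^ p)"
    by (intro tendsto_intros s)
  ultimately have "(\<Sum>p<P. c p * d ^ p) \<le> real j + 1"
    by (intro tendsto_upperbound) auto
  moreover have "c n * d ^ n \<le> (\<Sum>p<P. c p * d ^ p)"
    using cpos d unfolding P_def by (intro member_le_sum) (auto simp: less_imp_le)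
  ultimately have "c n * d ^ n \<le> real j + 1" by linarith
  then show ?thesis
    using j unfolding d_def by (simp add: field_simps power_divide)
qed

section \<open>Restriction of germs to a coordinate axis\<close>

definition axis_multi_index :: "'n \<Rightarrow> nat \<Rightarrow> 'n \<Rightarrow> nat" where
  "axis_multi_index i n = (\<lambda>_. 0)(i := n)"

lemma mlen_axis_multi_index [simp]: "mlen (axis_multi_index i n) = n"
  unfolding mlen_def axis_multi_index_def by (simp add: sum.delta fun_upd_def)

text \<open>The pure derivatives in direction \<open>i\<close>, restricted to a short segment of the
  axis, form the required one-variable family, with the Roumieu bounds on that segment.\<close>

lemma jets_of_germs_axis:
  fixes b :: "('n::finite \<Rightarrow> nat) \<Rightarrow> real" and i :: 'n
  assumes Mt: "weight_matrix Mt" and b: "b \<in> jets_of_germs Mt"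
  obtains j where "0 < j" "(\<lambda>n. b (axis_multi_index i n)) \<in> axis_jets Mt j"
proof -
  obtain k f and D :: "('n \<Rightarrow> nat) \<Rightarrow> real^'n \<Rightarrow> real" where k: "0 < k"
    and smooth: "smooth_with_partials (cube k) f D"
    and bounds: "roumieu_bounds Mt (cube k) D"
    and b_eq: "b = (\<lambda>\<alpha>. D \<alpha> 0 / fact (mlen \<alpha>))"
    using b unfolding jets_of_germs_def by blast
  \<comment> \<open>Since \<open>1 / real (Suc k)\<close> is strictly below
    \<open>1 / real k\<close>, the closed segment is a compact subset of the open cube.\<close>
  define d where "d = 1 / real (Suc k)"
  define K where "K = (\<lambda>t. t *\<^sub>R (axis i 1 :: real^'n)) ` {0..d}"
  have in_cube: "t *\<^sub>R (axis i 1 :: real^'n) \<in> cube k" if "0 \<le> t" "t \<le> d" for t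
  proof -
    have "d < 1 / real k" using k by (simp add: d_def field_simps)
    then show ?thesis
      using that k unfolding cube_def by (auto simp: axis_def)
  qed
  have "compact K" unfolding K_def
    by (intro compact_continuous_image continuous_intros) auto
  moreover have "K \<subseteq> cube k" unfolding K_def using in_cube by auto
  ultimately obtain l h where lh: "0 < l" "0 < h"
    and "bdd_above {\<bar>D \<alpha> x\<bar> / (h ^ mlen \<alpha> * Mt l (mlen \<alpha>)) | \<alpha> x. x \<in> K}"
    using bounds unfolding roumieu_bounds_def by meson
  then obtain C where C: "\<And>\<alpha> x. x \<in> K \<Longrightarrow> \<bar>D \<alpha> x\<bar> / (h ^ mlen \<alpha> * Mt l (mlen \<alpha>)) \<le> C"
    unfolding bdd_above_def by blast
  \<comment> \<open>One integer dominates the constant, the matrix index, the radius and the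
    reciprocal of the segment length.\<close>
  obtain j where j: "max (max C l) (max h (real (Suc k))) \<le> real j"
    using real_arch_simple by blast
  have j0: "0 < j" using j by (auto intro: Nat.gr0I)
  define g where "g n t = D (axis_multi_index i n) (t *\<^sub>R axis i 1)" for n t
  have dj: "t \<le> d" if "t \<le> 1 / real j" for t
  proof -
    have "1 / real j \<le> d" unfolding d_def using j by (intro divide_left_mono) auto
    then show ?thesis using that by simp
  qed
  have "(g n has_real_derivative g (Suc n) t) (at t)" if "0 \<le> t" "t \<le> 1 / real j" for n t
  proof -
    have "((\<lambda>s. D (axis_multi_index i n) (t *\<^sub>R axis i 1 + s *\<^sub>R axis i 1)) has_real_derivative
        D ((axis_multi_index i n)(i := Suc (axis_multi_index i n i))) (t *\<^sub>R axis i 1)) (at 0)"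
      using smooth in_cube that dj unfolding smooth_with_partials_def by blast
    moreover have "(axis_multi_index i n)(i := Suc (axis_multi_index i n i)) = axis_multi_index i (Suc n)"
      by (simp add: axis_multi_index_def)
    ultimately have "((\<lambda>s. g n (s + t)) has_real_derivative g (Suc n) t) (at 0)"
      unfolding g_def by (simp add: scaleR_left_distrib add.commute)
    then show ?thesis
      using DERIV_shift[of "g n" "g (Suc n) t" 0 t] by simp
  qed
  moreover have "\<bar>g n t\<bar> \<le> real j ^ Suc n * Mt (real j) n" if t: "0 \<le> t" "t \<le> 1 / real j" for n t
  proof -
    have pos: "0 < Mt l n" using weight_matrix_pos[OF Mt lh(1)] .
    have "t *\<^sub>R axis i 1 \<in> K" using t dj unfolding K_def by auto
    from C[OF this, of "axis_multi_index i n"] have "\<bar>g n t\<bar> \<le> C * (h ^ n * Mt l n)"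
      using lh pos unfolding g_def by (simp add: field_simps)
    also have "\<dots> \<le> real j * (real j ^ n * Mt (real j) n)"
      using j lh pos weight_matrix_mono[OF Mt lh(1), of "real j" n]
      by (intro mult_mono power_mono) auto
    finally show ?thesis by simp
  qed
  moreover have "b (axis_multi_index i n) = g n 0 / fact n" for n
    unfolding b_eq g_def by simp
  ultimately have "(\<lambda>n. b (axis_multi_index i n)) \<in> axis_jets Mt j"
    unfolding axis_jets_def by blast
  with j0 that show ?thesis by blast
qed

subsection \<open>The topology of the Beurling sequence space\<close>

text \<open>The denominator in \<open>seqnorm\<close>, named so that bounds on quotients can be
  handled as products.\<close>

definition seq_weight :: "(real \<Rightarrow> nat \<Rightarrow> real) \<Rightarrow> real \<Rightarrow> real \<Rightarrow> ('n::finite \<Rightarrow> nat) \<Rightarrow> real" where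
  "seq_weight Nt l h \<alpha> = h ^ mlen \<alpha> * (Nt l (mlen \<alpha>) / fact (mlen \<alpha>))"

lemma seq_weight_pos: "weight_matrix Nt \<Longrightarrow> 0 < l \<Longrightarrow> 0 < h \<Longrightarrow> 0 < seq_weight Nt l h \<alpha>"
  by (simp add: seq_weight_def weight_matrix_pos)

lemma seq_weight_mono:
  assumes "weight_matrix Nt" "0 < l" "l \<le> l'" "0 < h" "h \<le> h'"
  shows "seq_weight Nt l h \<alpha> \<le> seq_weight Nt l' h' \<alpha>"
  unfolding seq_weight_def
  using assms weight_matrix_pos[OF assms(1,2), of "mlen \<alpha>"] weight_matrix_mono[OF assms(1,2,3)]
  by (intro mult_mono power_mono divide_right_mono) auto

lemma Lambda_beurling_iff:
  assumes "weight_matrix Nt"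
  shows "b \<in> Lambda_beurling Nt \<longleftrightarrow>
    (\<forall>l>0. \<forall>h>0. \<exists>C. \<forall>\<alpha>. \<bar>b \<alpha>\<bar> \<le> C * seq_weight Nt l h \<alpha>)"
  unfolding Lambda_beurling_def seq_weight_def[symmetric] bdd_above_def
  by (simp add: pos_divide_le_eq seq_weight_pos[OF assms])

lemma Lambda_beurling_lin_comb:
  assumes Nt: "weight_matrix Nt" and x: "x \<in> Lambda_beurling Nt" and y: "y \<in> Lambda_beurling Nt"
  shows "(\<lambda>\<alpha>. a * x \<alpha> + c * y \<alpha>) \<in> Lambda_beurling Nt"
  unfolding Lambda_beurling_iff[OF Nt]
proof (intro allI impI)
  fix l h :: real assume lh: "0 < l" "0 < h"
  obtain C where C: "\<And>\<alpha>. \<bar>x \<alpha>\<bar> \<le> C * seq_weight Nt l h \<alpha>"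
    using x lh unfolding Lambda_beurling_iff[OF Nt] by blast
  obtain C' where C': "\<And>\<alpha>. \<bar>y \<alpha>\<bar> \<le> C' * seq_weight Nt l h \<alpha>"
    using y lh unfolding Lambda_beurling_iff[OF Nt] by blast
  have "\<bar>a * x \<alpha> + c * y \<alpha>\<bar> \<le> (\<bar>a\<bar> * C + \<bar>c\<bar> * C') * seq_weight Nt l h \<alpha>" for \<alpha>
  proof -
    have "\<bar>a * x \<alpha> + c * y \<alpha>\<bar> \<le> \<bar>a\<bar> * \<bar>x \<alpha>\<bar> + \<bar>c\<bar> * \<bar>y \<alpha>\<bar>"
      by (metis abs_mult abs_triangle_ineq)
    also have "\<dots> \<le> \<bar>a\<bar> * (C * seq_weight Nt l h \<alpha>) + \<bar>c\<bar> * (C' * seq_weight Nt l h \<alpha>)"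
      using C C' by (intro add_mono mult_left_mono) auto
    finally show ?thesis by (simp add: algebra_simps)
  qed
  then show "\<exists>C. \<forall>\<alpha>. \<bar>a * x \<alpha> + c * y \<alpha>\<bar> \<le> C * seq_weight Nt l h \<alpha>" by blast
qed

lemma Lambda_beurling_diff:
  assumes "weight_matrix Nt" "x \<in> Lambda_beurling Nt" "y \<in> Lambda_beurling Nt"
  shows "(\<lambda>\<alpha>. x \<alpha> - y \<alpha>) \<in> Lambda_beurling Nt"
  using Lambda_beurling_lin_comb[OF assms, of 1 "-1"] by simp

lemma abs_le_seqnorm:
  assumes "weight_matrix Nt" "0 < l" "0 < h" "b \<in> Lambda_beurling Nt"
  shows "\<bar>b \<alpha>\<bar> \<le> seqnorm Nt l h b * seq_weight Nt l h \<alpha>"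
proof -
  have "\<bar>b \<alpha>\<bar> / seq_weight Nt l h \<alpha> \<le> seqnorm Nt l h b"
    using assms unfolding seqnorm_def Lambda_beurling_def seq_weight_def
    by (intro cSUP_upper) auto
  then show ?thesis
    using seq_weight_pos[OF assms(1-3), of \<alpha>] by (simp add: pos_divide_le_eq)
qed

lemma seqnorm_leI:
  assumes "weight_matrix Nt" "0 < l" "0 < h" "\<And>\<alpha>. \<bar>b \<alpha>\<bar> \<le> C * seq_weight Nt l h \<alpha>"
  shows "seqnorm Nt l h b \<le> C"
  unfolding seqnorm_def seq_weight_def[symmetric]
  using assms(4) by (intro cSUP_least) (auto simp: pos_divide_le_eq seq_weight_pos[OF assms(1-3)])

lemma seqnorm_nonneg:
  fixes b :: "('n::finite \<Rightarrow> nat) \<Rightarrow> real"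
  assumes "weight_matrix Nt" "0 < l" "0 < h" "b \<in> Lambda_beurling Nt"
  shows "0 \<le> seqnorm Nt l h b"
proof -
  have "0 \<le> seqnorm Nt l h b * seq_weight Nt l h (\<lambda>_::'n. 0)"
    by (rule order_trans[OF abs_ge_zero abs_le_seqnorm[OF assms]])
  then show ?thesis
    using seq_weight_pos[OF assms(1-3), of "\<lambda>_::'n. 0"] by (simp add: zero_le_mult_iff)
qed

text \<open>The weights grow with both parameters. Hence the seminorms form a directed family:
  taking minima of the parameters dominates two given seminorms.\<close>

lemma seqnorm_antimono:
  assumes "weight_matrix Nt" "0 < l" "l \<le> l'" "0 < h" "h \<le> h'" "b \<in> Lambda_beurling Nt"
  shows "seqnorm Nt l' h' b \<le> seqnorm Nt l h b"
proof (rule seqnorm_leI)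
  fix \<alpha>
  have "\<bar>b \<alpha>\<bar> \<le> seqnorm Nt l h b * seq_weight Nt l h \<alpha>"
    using assms by (intro abs_le_seqnorm) auto
  also have "\<dots> \<le> seqnorm Nt l h b * seq_weight Nt l' h' \<alpha>"
    using assms by (intro mult_left_mono seq_weight_mono seqnorm_nonneg) auto
  finally show "\<bar>b \<alpha>\<bar> \<le> seqnorm Nt l h b * seq_weight Nt l' h' \<alpha>" .
qed (use assms in auto)

text \<open>\<open>topology\<close> yields the intended open sets only once
  \<open>istopology\<close> is verified; for intersections this uses the directedness of the
  seminorms.\<close>

lemma openin_Lambda_top:
  assumes Nt: "weight_matrix Nt"
  shows "openin (Lambda_top Nt) = (Lambda_open Nt :: (('n::finite \<Rightarrow> nat) \<Rightarrow> real) set \<Rightarrow> bool)"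
proof -
  have "Lambda_open Nt (S \<inter> T)" if S: "Lambda_open Nt S" and T: "Lambda_open Nt T"
    for S T :: "(('n \<Rightarrow> nat) \<Rightarrow> real) set"
    unfolding Lambda_open_def
  proof (intro conjI ballI)
    show "S \<inter> T \<subseteq> Lambda_beurling Nt"
      using S unfolding Lambda_open_def by blast
    fix x assume x: "x \<in> S \<inter> T"
    then have xL: "x \<in> Lambda_beurling Nt"
      using S unfolding Lambda_open_def by blast
    obtain l h e where 1: "0 < l" "0 < h" "0 < e"
      "{y \<in> Lambda_beurling Nt. seqnorm Nt l h (\<lambda>\<alpha>. y \<alpha> - x \<alpha>) < e} \<subseteq> S"
      using S x unfolding Lambda_open_def by blast
    obtain l' h' e' where 2: "0 < l'" "0 < h'" "0 < e'"
      "{y \<in> Lambda_beurling Nt. seqnorm Nt l' h' (\<lambda>\<alpha>. y \<alpha> - x \<alpha>) < e'} \<subseteq> T"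
      using T x unfolding Lambda_open_def by blast
    have "{y \<in> Lambda_beurling Nt. seqnorm Nt (min l l') (min h h') (\<lambda>\<alpha>. y \<alpha> - x \<alpha>) < min e e'} \<subseteq> S \<inter> T"
    proof
      fix y assume "y \<in> {y \<in> Lambda_beurling Nt. seqnorm Nt (min l l') (min h h') (\<lambda>\<alpha>. y \<alpha> - x \<alpha>) < min e e'}"
      then have y: "y \<in> Lambda_beurling Nt"
        "seqnorm Nt (min l l') (min h h') (\<lambda>\<alpha>. y \<alpha> - x \<alpha>) < min e e'" by auto
      have diff: "(\<lambda>\<alpha>. y \<alpha> - x \<alpha>) \<in> Lambda_beurling Nt"
        by (intro Lambda_beurling_diff Nt y xL)
      have "seqnorm Nt l h (\<lambda>\<alpha>. y \<alpha> - x \<alpha>) < e" "seqnorm Nt l' h' (\<lambda>\<alpha>. y \<alpha> - x \<alpha>) < e'"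
        using y(2) seqnorm_antimono[OF Nt _ _ _ _ diff, of "min l l'" l "min h h'" h]
          seqnorm_antimono[OF Nt _ _ _ _ diff, of "min l l'" l' "min h h'" h'] 1(1,2) 2(1,2)
        by simp_all
      then show "y \<in> S \<inter> T" using 1(4) 2(4) y(1) by blast
    qed
    moreover have "0 < min l l'" "0 < min h h'" "0 < min e e'" using 1 2 by auto
    ultimately show "\<exists>l>0. \<exists>h>0. \<exists>e>0.
        {y \<in> Lambda_beurling Nt. seqnorm Nt l h (\<lambda>\<alpha>. y \<alpha> - x \<alpha>) < e} \<subseteq> S \<inter> T"
      by blast
  qed
  moreover have "Lambda_open Nt (\<Union>\<K>)" if opens: "\<forall>S\<in>\<K>. Lambda_open Nt S"
    for \<K> :: "(('n \<Rightarrow> nat) \<Rightarrow> real) set set"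
    unfolding Lambda_open_def
  proof (intro conjI ballI)
    show "\<Union>\<K> \<subseteq> Lambda_beurling Nt"
      using opens unfolding Lambda_open_def by blast
    fix x assume "x \<in> \<Union>\<K>"
    then obtain S where S: "S \<in> \<K>" "x \<in> S" by blast
    then obtain l h e where "0 < l" "0 < h" "0 < e"
      "{y \<in> Lambda_beurling Nt. seqnorm Nt l h (\<lambda>\<alpha>. y \<alpha> - x \<alpha>) < e} \<subseteq> S"
      using opens unfolding Lambda_open_def by blast
    then show "\<exists>l>0. \<exists>h>0. \<exists>e>0.
        {y \<in> Lambda_beurling Nt. seqnorm Nt l h (\<lambda>\<alpha>. y \<alpha> - x \<alpha>) < e} \<subseteq> \<Union>\<K>"
      using S(1) by (meson Union_upper order_trans)
  qed
  ultimately have "istopology (Lambda_open Nt :: (('n \<Rightarrow> nat) \<Rightarrow> real) set \<Rightarrow> bool)"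
    unfolding istopology_def by blast
  then show ?thesis
    unfolding Lambda_top_def by (rule topology_inverse')
qed

lemma topspace_Lambda_top:
  assumes "weight_matrix Nt"
  shows "topspace (Lambda_top Nt) = Lambda_beurling Nt"
proof
  show "topspace (Lambda_top Nt) \<subseteq> Lambda_beurling Nt"
    unfolding topspace_def openin_Lambda_top[OF assms] Lambda_open_def by blast
  have "Lambda_open Nt (Lambda_beurling Nt)"
    unfolding Lambda_open_def by (auto intro!: exI[of _ "1::real"])
  then show "Lambda_beurling Nt \<subseteq> topspace (Lambda_top Nt)"
    unfolding topspace_def openin_Lambda_top[OF assms] by blast
qed

text \<open>The single seminorm with both parameters 1 controls a coordinate up to the factor
  \<open>seq_weight Nt 1 1 \<alpha>\<close>.\<close>

lemma continuous_map_Lambda_coordinate: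
  assumes Nt: "weight_matrix Nt"
  shows "continuous_map (Lambda_top Nt) euclideanreal (\<lambda>y. y \<alpha>)"
  unfolding continuous_map_def topspace_Lambda_top[OF Nt] openin_Lambda_top[OF Nt] open_openin[symmetric]
proof (intro conjI allI impI)
  fix V :: "real set" assume V: "open V"
  show "Lambda_open Nt {x \<in> Lambda_beurling Nt. x \<alpha> \<in> V}"
    unfolding Lambda_open_def
  proof (intro conjI ballI)
    fix x assume x: "x \<in> {x \<in> Lambda_beurling Nt. x \<alpha> \<in> V}"
    then obtain e where e: "0 < e" "ball (x \<alpha>) e \<subseteq> V"
      using V open_contains_ball by blast
    define w where "w = seq_weight Nt 1 1 \<alpha>"
    have w: "0 < w" unfolding w_def by (simp add: seq_weight_pos[OF Nt])
    have "{y \<in> Lambda_beurling Nt. seqnorm Nt 1 1 (\<lambda>\<alpha>. y \<alpha> - x \<alpha>) < e / w}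
        \<subseteq> {x \<in> Lambda_beurling Nt. x \<alpha> \<in> V}"
    proof safe
      fix y assume y: "y \<in> Lambda_beurling Nt" "seqnorm Nt 1 1 (\<lambda>\<alpha>. y \<alpha> - x \<alpha>) < e / w"
      have "\<bar>y \<alpha> - x \<alpha>\<bar> \<le> seqnorm Nt 1 1 (\<lambda>\<alpha>. y \<alpha> - x \<alpha>) * w"
        unfolding w_def using abs_le_seqnorm[OF Nt _ _ Lambda_beurling_diff[OF Nt y(1)]] x by simp
      also have "\<dots> < e" using y(2) w by (simp add: pos_less_divide_eq)
      finally show "y \<alpha> \<in> V" using e(2) by (auto simp: dist_real_def subset_iff)
    qed
    then show "\<exists>l>0. \<exists>h>0. \<exists>e>0. {y \<in> Lambda_beurling Nt. seqnorm Nt l h (\<lambda>\<alpha>. y \<alpha> - x \<alpha>) < e}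
        \<subseteq> {x \<in> Lambda_beurling Nt. x \<alpha> \<in> V}"
      using e w by (meson divide_pos_pos zero_less_one)
  qed auto
qed auto

text \<open>The map is Lipschitz for every seminorm, with the seminorm of \<open>b\<close> as
  constant.\<close>

lemma continuous_map_Lambda_line:
  fixes b :: "('n::finite \<Rightarrow> nat) \<Rightarrow> real"
  assumes Nt: "weight_matrix Nt" and b: "b \<in> Lambda_beurling Nt"
  shows "continuous_map euclideanreal (Lambda_top Nt) (\<lambda>t \<alpha>. t * b \<alpha>)"
  unfolding continuous_map_def topspace_Lambda_top[OF Nt] openin_Lambda_top[OF Nt] open_openin[symmetric]
proof (intro conjI allI impI)
  show "(\<lambda>t \<alpha>. t * b \<alpha>) \<in> topspace euclideanreal \<rightarrow> Lambda_beurling Nt"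
    using Lambda_beurling_lin_comb[OF Nt b b, of _ 0] by simp
  fix U :: "(('n \<Rightarrow> nat) \<Rightarrow> real) set" assume U: "Lambda_open Nt U"
  have "\<exists>e>0. ball t e \<subseteq> {t. (\<lambda>\<alpha>. t * b \<alpha>) \<in> U}" if t: "(\<lambda>\<alpha>. t * b \<alpha>) \<in> U" for t
  proof -
    obtain l h e where lhe: "0 < l" "0 < h" "0 < e"
      "{y \<in> Lambda_beurling Nt. seqnorm Nt l h (\<lambda>\<alpha>. y \<alpha> - t * b \<alpha>) < e} \<subseteq> U"
      using bspec[OF conjunct2[OF U[unfolded Lambda_open_def]] t] by (elim exE conjE)
    define r where "r = seqnorm Nt l h b"
    have r: "0 \<le> r" unfolding r_def by (rule seqnorm_nonneg[OF Nt lhe(1,2) b])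
    \<comment> \<open>Dividing by \<open>r + 1\<close> rather than \<open>r\<close> covers the case
      \<open>r = 0\<close>.\<close>
    have "(\<lambda>\<alpha>. s * b \<alpha>) \<in> U" if "s \<in> ball t (e / (r + 1))" for s
    proof -
      have "seqnorm Nt l h (\<lambda>\<alpha>. s * b \<alpha> - t * b \<alpha>) \<le> \<bar>s - t\<bar> * r"
      proof (rule seqnorm_leI[OF Nt lhe(1,2)])
        fix \<alpha>
        have "\<bar>s - t\<bar> * \<bar>b \<alpha>\<bar> \<le> \<bar>s - t\<bar> * (r * seq_weight Nt l h \<alpha>)"
          unfolding r_def using abs_le_seqnorm[OF Nt lhe(1,2) b] by (intro mult_left_mono) auto
        then show "\<bar>s * b \<alpha> - t * b \<alpha>\<bar> \<le> \<bar>s - t\<bar> * r * seq_weight Nt l h \<alpha>"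
          by (simp add: left_diff_distrib[symmetric] abs_mult mult.assoc)
      qed
      also have "\<dots> \<le> \<bar>s - t\<bar> * (r + 1)" by (intro mult_left_mono) auto
      also have "\<dots> < e"
        using that r by (simp add: pos_less_divide_eq dist_real_def abs_minus_commute)
      finally show ?thesis
        using lhe(4) Lambda_beurling_lin_comb[OF Nt b b, of s 0] by auto
    qed
    then show ?thesis using lhe(3) r by (intro exI[of _ "e / (r + 1)"]) auto
  qed
  then have "open {t. (\<lambda>\<alpha>. t * b \<alpha>) \<in> U}"
    unfolding open_contains_ball by blast
  then show "open {t \<in> topspace euclideanreal. (\<lambda>\<alpha>. t * b \<alpha>) \<in> U}" by simp
qed

text \<open>Coordinates are continuous and separate points. The Hausdorff property makes compact
  sets closed and hence Borel.\<close>

lemma Hausdorff_space_Lambda_top: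
  assumes Nt: "weight_matrix Nt"
  shows "Hausdorff_space (Lambda_top Nt :: (('n::finite \<Rightarrow> nat) \<Rightarrow> real) topology)" (is "Hausdorff_space ?T")
  unfolding Hausdorff_space_def
proof (intro allI impI)
  fix x y assume xy: "x \<in> topspace ?T \<and> y \<in> topspace ?T \<and> x \<noteq> y"
  then obtain \<alpha> where "x \<alpha> \<noteq> y \<alpha>" by blast
  then obtain U V where UV: "open U" "open V" "x \<alpha> \<in> U" "y \<alpha> \<in> V" "U \<inter> V = {}"
    using hausdorff by meson
  let ?p = "\<lambda>U. {z \<in> topspace ?T. z \<alpha> \<in> U}"
  have "openin ?T (?p U)" "openin ?T (?p V)"
    using UV openin_continuous_map_preimage[OF continuous_map_Lambda_coordinate[OF Nt]] by auto
  moreover have "disjnt (?p U) (?p V)" using UV(5) by (auto simp: disjnt_def)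
  ultimately show "\<exists>U V. openin ?T U \<and> openin ?T V \<and> x \<in> U \<and> y \<in> V \<and> disjnt U V"
    using xy UV by blast
qed

lemma closedin_Lambda_borel:
  assumes Nt: "weight_matrix Nt" and S: "closedin (Lambda_top Nt) S"
  shows "S \<in> Lambda_borel Nt"
proof -
  have "Lambda_beurling Nt - S \<in> Lambda_borel Nt"
    using S unfolding Lambda_borel_def closedin_def topspace_Lambda_top[OF Nt] by blast
  then have "Lambda_beurling Nt - (Lambda_beurling Nt - S) \<in> Lambda_borel Nt"
    unfolding Lambda_borel_def by (rule sigma_sets.Compl)
  moreover have "S \<subseteq> Lambda_beurling Nt"
    using S unfolding closedin_def topspace_Lambda_top[OF Nt] by blast
  ultimately show ?thesis by (simp add: double_diff)
qed

subsection \<open>Haar-nullness\<close>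

text \<open>Diagonal choice: the geometric rate at \<open>n\<close> is the largest \<open>j\<close> for which the weights of
  index \<open>1 / Suc j\<close> already dominate the squared rate from \<open>n\<close> onwards; one factor of the square
  absorbs \<open>h\<close>.\<close>
lemma fast_growing_Beurling_sequence:
  assumes Nt: "weight_matrix Nt"
    and lim: "\<forall>l>0. filterlim (\<lambda>k. root k (Nt l k / fact k)) at_top sequentially"
  obtains c :: "nat \<Rightarrow> real" where
    "\<And>n. 0 < c n"
    "\<And>l h. 0 < l \<Longrightarrow> 0 < h \<Longrightarrow> \<exists>C. \<forall>n. c n \<le> C * (h ^ n * (Nt l n / fact n))"
    "\<And>j::nat. \<exists>n. (real j + 1) * real j ^ n < c n"
proof -
  define A where "A j n \<longleftrightarrow> (\<forall>m\<ge>n. real (Suc j) ^ (2 * m) \<le> Nt (1 / real (Suc j)) m / fact m)" for j n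
  \<comment> \<open>The bound \<open>j \<le> n\<close> keeps the set finite, and
    \<open>insert 0\<close> keeps it nonempty.\<close>
  define W where "W n = Max (insert 0 {j. j \<le> n \<and> A j n})" for n
  define c where "c n = real (Suc (W n)) ^ n" for n
  have ex: "\<exists>n. A j n" for j
  proof -
    let ?l = "1 / real (Suc j)"
    have "\<forall>\<^sub>F k in sequentially. (real (Suc j))\<^sup>2 \<le> root k (Nt ?l k / fact k)"
      using lim by (simp add: filterlim_at_top)
    then have "\<forall>\<^sub>F k in sequentially. real (Suc j) ^ (2 * k) \<le> Nt ?l k / fact k"
      using eventually_gt_at_top[of 0]
    proof eventually_elim
      case (elim k)
      have "real (Suc j) ^ (2 * k) = ((real (Suc j))\<^sup>2) ^ k" by (simp add: power_mult)
      also have "\<dots> \<le> root k (Nt ?l k / fact k) ^ k"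
        using elim by (intro power_mono) auto
      also have "\<dots> = Nt ?l k / fact k"
        using elim weight_matrix_pos[OF Nt, of ?l k] by (intro real_root_pow_pos) auto
      finally show ?case .
    qed
    then show ?thesis unfolding A_def eventually_sequentially .
  qed
  have W: "i \<le> W n" "A (W n) n" if "A i n" "i \<le> n" for i n
  proof -
    have fin: "finite (insert 0 {j. j \<le> n \<and> A j n})" by simp
    show ge: "i \<le> W n" unfolding W_def using fin that by (intro Max_ge) auto
    have "W n \<in> insert 0 {j. j \<le> n \<and> A j n}" unfolding W_def using fin by (intro Max_in) auto
    \<comment> \<open>If the maximum is the inserted 0, then \<open>i = 0\<close> and
      \<open>A i n\<close> itself is the claim.\<close>
    with ge that show "A (W n) n" by auto
  qed
  have A_mono: "A i n" if "A i k" "k \<le> n" for i k n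
    using that unfolding A_def by auto
  show thesis
  proof
    show "0 < c n" for n by (simp add: c_def)
    fix l h :: real assume lh: "0 < l" "0 < h"
    define w where "w n = h ^ n * (Nt l n / fact n)" for n
    have w: "0 < w n" for n unfolding w_def using weight_matrix_pos[OF Nt lh(1)] lh by simp
    \<comment> \<open>This \<open>i\<close> serves both parameters: once
      \<open>v \<ge> real (Suc i)\<close>, both \<open>1 / v \<le> l\<close> and
      \<open>h * v \<ge> 1\<close> hold.\<close>
    obtain i where i: "inverse (real (Suc i)) < min l h"
      using reals_Archimedean[of "min l h"] lh by auto
    obtain k where k: "A i k" using ex by blast
    have large: "c n \<le> w n" if n: "max i k \<le> n" for n
    proof -
      have Ain: "A i n" "i \<le> n" using A_mono[OF k] n by auto
      define v where "v = real (Suc (W n))"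
      have v: "real (Suc i) \<le> v" "0 < v" using W(1)[OF Ain] v_def by auto
      have "v ^ (2 * n) \<le> Nt (1 / v) n / fact n"
        using W(2)[OF Ain] unfolding A_def v_def by blast
      also have "1 / v \<le> l"
      proof -
        have "1 / v \<le> 1 / real (Suc i)" using v by (intro divide_left_mono) auto
        then show ?thesis using i by (simp add: inverse_eq_divide)
      qed
      then have "Nt (1 / v) n / fact n \<le> Nt l n / fact n"
        using v by (intro divide_right_mono weight_matrix_mono[OF Nt]) auto
      finally have "v ^ (2 * n) \<le> Nt l n / fact n" .
      then have "h ^ n * v ^ (2 * n) \<le> w n"
        unfolding w_def using lh by (intro mult_left_mono) auto
      moreover have "1 ^ n \<le> (h * v) ^ n"
      proof (rule power_mono)
        have "1 = inverse (real (Suc i)) * real (Suc i)" by simp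
        also have "\<dots> \<le> h * v" using i v lh by (intro mult_mono) auto
        finally show "1 \<le> h * v" .
      qed simp
      then have "1 * v ^ n \<le> (h * v) ^ n * v ^ n"
        using v by (intro mult_right_mono) auto
      ultimately show ?thesis
        unfolding c_def v_def[symmetric] by (simp add: power_mult_distrib mult_2 power_add)
    qed
    \<comment> \<open>The 1 handles large \<open>n\<close>; the sum handles the finitely many
      remaining indices.\<close>
    define C where "C = 1 + (\<Sum>n<max i k. c n / w n)"
    have terms: "0 \<le> c n / w n" for n using w[of n] by (simp add: c_def)
    have "c n \<le> C * w n" for n
    proof (cases "max i k \<le> n")
      case True
      have "1 \<le> C" unfolding C_def using terms by (simp add: sum_nonneg)
      then have "1 * w n \<le> C * w n" using w[of n] by (intro mult_right_mono) auto
      then show ?thesis using large[OF True] by simp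
    next
      case False
      then have "c n / w n \<le> (\<Sum>n<max i k. c n / w n)"
        using terms by (intro member_le_sum) auto
      then have "c n / w n \<le> C" unfolding C_def by simp
      then show ?thesis using w[of n] by (simp add: pos_divide_le_eq)
    qed
    then show "\<exists>C. \<forall>n. c n \<le> C * (h ^ n * (Nt l n / fact n))"
      unfolding w_def by blast
  next
    fix j :: nat
    \<comment> \<open>Index \<open>2 * j + 1\<close> gives the rate \<open>2 * (j + 1)\<close>; the
      spare factor \<open>2 ^ n\<close> beats the constant \<open>real j + 1\<close>.\<close>
    obtain k where k: "A (2 * j + 1) k" using ex by blast
    define n where "n = max k (2 * j + 1)"
    have "A (2 * j + 1) n" "2 * j + 1 \<le> n" using A_mono[OF k] n_def by auto
    note W(1)[OF this]
    then have "(2 * (real j + 1)) ^ n \<le> c n"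
      unfolding c_def by (intro power_mono) auto
    moreover have "(real j + 1) * real j ^ n < 2 ^ n * (real j + 1) ^ n"
    proof -
      have "real j + 1 \<le> real n" using \<open>2 * j + 1 \<le> n\<close> by simp
      also have "\<dots> < 2 ^ n" by (rule of_nat_less_two_power)
      finally have "real j + 1 < 2 ^ n" .
      have "(real j + 1) * real j ^ n \<le> (real j + 1) * (real j + 1) ^ n"
        by (intro mult_left_mono power_mono) auto
      also have "\<dots> < 2 ^ n * (real j + 1) ^ n"
        using \<open>real j + 1 < 2 ^ n\<close> by (intro mult_strict_right_mono) auto
      finally show ?thesis .
    qed
    ultimately show "\<exists>n. (real j + 1) * real j ^ n < c n"
      unfolding power_mult_distrib by (intro exI[of _ n]) linarith
  qed
qed

theorem mainTheorem12:
  fixes Mt Nt :: "real \<Rightarrow> nat \<Rightarrow> real"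
  assumes "weight_matrix Mt" and "quasianalytic_matrix Mt"
    and "weight_matrix Nt" and "quasianalytic_matrix Nt"
    and "\<forall>l>0. filterlim (\<lambda>k. root k (Nt l k / fact k)) at_top sequentially"
  shows "haar_null_Lambda Nt
           ((jets_of_germs Mt :: (('n::finite \<Rightarrow> nat) \<Rightarrow> real) set) \<inter> Lambda_beurling Nt)"
proof -
  note Mt = assms(1,2) and Nt = assms(3)
  obtain c :: "nat \<Rightarrow> real" where c_pos: "\<And>n. 0 < c n"
    and c_bd: "\<And>l h. 0 < l \<Longrightarrow> 0 < h \<Longrightarrow> \<exists>C. \<forall>n. c n \<le> C * (h ^ n * (Nt l n / fact n))"
    and c_fast: "\<And>j::nat. \<exists>n. (real j + 1) * real j ^ n < c n"
    using fast_growing_Beurling_sequence[OF Nt assms(5)] by metis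
  define i :: 'n where "i = undefined"
  define pr :: "(('n \<Rightarrow> nat) \<Rightarrow> real) \<Rightarrow> nat \<Rightarrow> real" where "pr y n = y (axis_multi_index i n)" for y n
  define L :: "(('n \<Rightarrow> nat) \<Rightarrow> real) set" where "L = Lambda_beurling Nt"
  \<comment> \<open>The fast sequence \<open>c\<close> is placed on axis \<open>i\<close> and
    extended by zero to all other multi-indices.\<close>
  define b :: "('n \<Rightarrow> nat) \<Rightarrow> real" where
    "b \<alpha> = (if \<alpha> = axis_multi_index i (\<alpha> i) then c (\<alpha> i) else 0)" for \<alpha>
  \<comment> \<open>\<open>Suc j\<close> avoids parameter 0, for which the interval degenerates and
    \<open>Mt 0\<close> is unconstrained.\<close>
  define B where "B = (\<Union>j. {y \<in> L. pr y \<in> closure (axis_jets Mt (Suc j))})"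

  have pr_b: "pr b = c"
    by (auto simp: pr_def b_def axis_multi_index_def fun_eq_iff)
  have bL: "b \<in> L"
    unfolding L_def Lambda_beurling_iff[OF Nt]
  proof (intro allI impI)
    fix l h :: real assume lh: "0 < l" "0 < h"
    then obtain C where C: "\<And>n. c n \<le> C * (h ^ n * (Nt l n / fact n))"
      using c_bd by blast
    have "0 < C"
      using C[of 0] c_pos[of 0] weight_matrix_pos[OF Nt lh(1), of 0]
      by (simp add: zero_less_mult_iff) (smt (verit) mult_nonpos_nonneg)
    have "\<bar>b \<alpha>\<bar> \<le> C * seq_weight Nt l h \<alpha>" for \<alpha>
    proof (cases "\<alpha> = axis_multi_index i (\<alpha> i)")
      case True
      then have "mlen \<alpha> = \<alpha> i" by (metis mlen_axis_multi_index)
      then show ?thesis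
        using True C[of "\<alpha> i"] c_pos[of "\<alpha> i"] by (simp add: b_def seq_weight_def)
    next
      case False
      then show ?thesis
        using \<open>0 < C\<close> seq_weight_pos[OF Nt lh, of \<alpha>] by (simp add: b_def)
    qed
    then show "\<exists>C. \<forall>\<alpha>. \<bar>b \<alpha>\<bar> \<le> C * seq_weight Nt l h \<alpha>" by blast
  qed

  have jets: "jets_of_germs Mt \<inter> Lambda_beurling Nt \<subseteq> B"
  proof
    fix y :: "('n \<Rightarrow> nat) \<Rightarrow> real" assume y: "y \<in> jets_of_germs Mt \<inter> Lambda_beurling Nt"
    obtain j where "0 < j" "(\<lambda>n. y (axis_multi_index i n)) \<in> axis_jets Mt j"
      using jets_of_germs_axis[OF Mt(1)] y by blast
    then have "pr y \<in> axis_jets Mt (Suc (j - 1))" by (simp add: pr_def[abs_def])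
    then have "pr y \<in> closure (axis_jets Mt (Suc (j - 1)))"
      using closure_subset by blast
    then show "y \<in> B" using y unfolding B_def L_def by blast
  qed

  \<comment> \<open>Restriction to the axis is continuous into the product topology, so
    \<open>B\<close> becomes a countable union of closed sets.\<close>
  have B_closed: "closedin (Lambda_top Nt) {y \<in> L. pr y \<in> closure S}" for S
  proof -
    have "continuous_map (Lambda_top Nt) euclidean pr"
      unfolding euclidean_product_topology[symmetric] continuous_map_componentwise_UNIV pr_def
      using continuous_map_Lambda_coordinate[OF Nt] by auto
    from closedin_continuous_map_preimage[OF this, of "closure S"] show ?thesis
      by (simp add: topspace_Lambda_top[OF Nt] L_def)
  qed
  have B_borel: "B \<in> Lambda_borel Nt"
  proof -
    have "{y \<in> L. pr y \<in> closure (axis_jets Mt (Suc j))} \<in> Lambda_borel Nt" for j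
      by (rule closedin_Lambda_borel[OF Nt B_closed])
    then show ?thesis unfolding B_def Lambda_borel_def by (rule sigma_sets.Union)
  qed

  \<comment> \<open>Subtracting the two equations eliminates \<open>x\<close> and leaves
    \<open>y - z = (s - t) b\<close>. For \<open>s \<noteq> t\<close>, rescaling along the axis
    would put \<open>c\<close> into one of the closures, where positive sequences grow at most
    geometrically.\<close>
  have B_line: "s = t"
    if s: "(\<lambda>\<alpha>. s * b \<alpha>) = (\<lambda>\<alpha>. x \<alpha> + y \<alpha>)" and t: "(\<lambda>\<alpha>. t * b \<alpha>) = (\<lambda>\<alpha>. x \<alpha> + z \<alpha>)"
      and yz: "y \<in> B" "z \<in> B" for s t x y z
  proof (rule ccontr)
    assume "s \<noteq> t"
    define a where "a = 1 / (s - t)"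
    obtain j1 j2 where j12: "pr y \<in> closure (axis_jets Mt (Suc j1))" "pr z \<in> closure (axis_jets Mt (Suc j2))"
      using yz unfolding B_def by blast
    define j where "j = max (Suc j1) (Suc j2)"
    have j: "0 < j" "pr y \<in> closure (axis_jets Mt j)" "pr z \<in> closure (axis_jets Mt j)"
      using j12 closure_mono[OF axis_jets_mono[OF Mt(1), of "Suc j1" j]]
        closure_mono[OF axis_jets_mono[OF Mt(1), of "Suc j2" j]] unfolding j_def by auto
    obtain k0 where k0: "2 * \<bar>a\<bar> * real j \<le> real k0" using real_arch_simple by blast
    define k where "k = max j k0"
    have "(\<lambda>n. a * (pr y n - pr z n)) \<in> closure (axis_jets Mt k)"
      by (rule closure_axis_jets_scaled_diff[OF Mt(1) j(1) _ _ j(2,3)]) (use k0 k_def in auto)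
    moreover have "a * (pr y n - pr z n) = c n" for n
    proof -
      have "(s - t) * c n = pr y n - pr z n"
        using fun_cong[OF s, of "axis_multi_index i n"] fun_cong[OF t, of "axis_multi_index i n"]
        unfolding pr_b[symmetric] pr_def by (simp add: algebra_simps)
      then show ?thesis using \<open>s \<noteq> t\<close> unfolding a_def by (metis nonzero_mult_div_cancel_left
        right_minus_eq times_divide_eq_left mult_1)
    qed
    ultimately have "c \<in> closure (axis_jets Mt k)" by simp
    moreover have "0 < k" using j k_def by simp
    ultimately have "c n \<le> (real k + 1) * real k ^ n" for n
      using closure_axis_jets_positive_growth[OF Mt] c_pos by blast
    then show False using c_fast[of k] by (meson not_less)
  qed

  \<comment> \<open>The uniform measure on the segment from 0 to \<open>b\<close>\<close>
  define \<phi> where "\<phi> t = (\<lambda>\<alpha>. t * b \<alpha>)" for t :: real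
  define U where "U = uniform_measure lborel {0..1::real}"
  define S where "S = sigma L {V. openin (Lambda_top Nt) V}"
  define \<mu> where "\<mu> = distr U S \<phi>"
  have opens: "{V. openin (Lambda_top Nt) V} \<subseteq> Pow L"
    unfolding L_def topspace_Lambda_top[OF Nt, symmetric] using openin_subset by blast
  have space_S: "space S = L" and sets_S: "sets S = Lambda_borel Nt"
    unfolding S_def Lambda_borel_def L_def[symmetric] using opens by auto
  have \<phi>_cont: "continuous_map euclideanreal (Lambda_top Nt) \<phi>"
    unfolding \<phi>_def using continuous_map_Lambda_line[OF Nt] bL L_def by blast
  have \<phi>_L: "\<phi> t \<in> L" for t
    using \<phi>_cont unfolding continuous_map_def topspace_Lambda_top[OF Nt] L_def by auto
  have meas: "\<phi> \<in> measurable U S"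
    unfolding S_def
  proof (rule measurable_measure_of[OF opens])
    fix V :: "(('n \<Rightarrow> nat) \<Rightarrow> real) set" assume "V \<in> {V. openin (Lambda_top Nt) V}"
    then have "open {t. \<phi> t \<in> V}"
      using openin_continuous_map_preimage[OF \<phi>_cont, of V] by simp
    then show "\<phi> -` V \<inter> space U \<in> sets U"
      by (simp add: U_def vimage_def)
  qed (use \<phi>_L in auto)
  have prob_U: "prob_space U"
    unfolding U_def by (intro prob_space_uniform_measure) auto
  have emeasure_\<mu>: "emeasure \<mu> X = emeasure lborel ({0..1} \<inter> \<phi> -` X)" if "X \<in> sets S" for X
  proof -
    \<comment> \<open>Since \<open>{0..1}\<close> has Lebesgue measure 1, the normalising
      denominator of the uniform measure disappears.\<close>
    have "\<phi> -` X \<in> sets borel"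
      using measurable_sets[OF meas that] by (simp add: U_def)
    then show ?thesis
      unfolding \<mu>_def emeasure_distr[OF meas that] by (simp add: U_def divide_ennreal_def)
  qed
  define K where "K = \<phi> ` {0..1}"
  have K: "compactin (Lambda_top Nt) K"
    unfolding K_def by (rule image_compactin[OF _ \<phi>_cont]) simp
  have K_borel: "K \<in> Lambda_borel Nt"
    by (intro closedin_Lambda_borel Nt compactin_imp_closedin Hausdorff_space_Lambda_top K)

  have "emeasure \<mu> K = 1"
  proof -
    have "{0..1} \<inter> \<phi> -` K = {0..1}" unfolding K_def by auto
    then show ?thesis using emeasure_\<mu>[of K] K_borel sets_S by simp
  qed
  moreover have "emeasure \<mu> ((\<lambda>y \<alpha>. x \<alpha> + y \<alpha>) ` B) = 0" (is "emeasure \<mu> ?X = 0") for x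
  proof (cases "?X \<in> sets S")
    case True
    have "s = t" if "\<phi> s \<in> ?X" "\<phi> t \<in> ?X" for s t
      using that B_line unfolding \<phi>_def by blast
    \<comment> \<open>By \<open>B_line\<close> at most one parameter hits the translate; the choice
      operator also covers the empty case, where its value is arbitrary.\<close>
    then have "{0..1} \<inter> \<phi> -` ?X \<subseteq> {SOME t. \<phi> t \<in> ?X}"
      by (auto intro: someI2)
    then have "countable ({0..1} \<inter> \<phi> -` ?X)"
      by (rule countable_subset) simp
    then show ?thesis
      unfolding emeasure_\<mu>[OF True] by (rule emeasure_lborel_countable)
  next
    case False \<comment> \<open>then the measure is 0 by convention\<close>
    then show ?thesis by (simp add: \<mu>_def emeasure_notin_sets)
  qed
  moreover have "prob_space \<mu>"
    unfolding \<mu>_def by (rule prob_space.prob_space_distr[OF prob_U meas])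
  moreover have "space \<mu> = Lambda_beurling Nt" "sets \<mu> = Lambda_borel Nt"
    unfolding \<mu>_def using space_S sets_S L_def by auto
  ultimately have "haar_null_borel_Lambda Nt B"
    unfolding haar_null_borel_Lambda_def using B_borel K K_borel by blast
  then show ?thesis
    unfolding haar_null_Lambda_def using jets by blast
qed

end
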